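(* Let $p$ be a prime, let $q$ be a power of $p$, and let $d$ be a positive integer with $2d=q+1$. Let $\mathcal{C}_d: y^d=\varphi_d(x)$ in characteristic $p$, where $\varphi_d$ is the $d$-th Chebyshev polynomial. Then $\mathcal{C}_d$ is isomorphic over $\mathbb{F}_{q^2}$ to the Fermat curve $\mathcal{F}: v^d=u^d+1$.
   Context: The $d$-th Chebyshev polynomial $\varphi_d(X)$ over a field $k$ is the unique monic polynomial with $\varphi_d(t+t^{-1})=t^d+t^{-d}$ in $k[t,t^{-1}]$; its coefficients lie in the prime field. Both $\mathcal{C}_d$ and $\mathcal{F}$ denote the projective plane curves obtained as closures in $\mathbb{P}^2$ of the given affine curves. A power of $p$ means $p^r$ with $r\geq 1$. *)

theory Defs
  imports
    "HOL-Analysis.Cartesian_Space"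
    "HOL-Algebra.Algebraic_Closure_Type"
    "HOL-Library.Poly_Mapping"
begin

unbundle no fps_syntax

section \<open>Chebyshev polynomials\<close>

text \<open>
  \<open>int \<Rightarrow>\<^sub>0 'a\<close> with the convolution product is the ring of Laurent polynomials \<open>'a[t, t\<inverse>]\<close>:
  \<open>Poly_Mapping.single n c\<close> is \<open>c t\<^sup>n\<close>.
\<close>

abbreviation laurent_mon :: "int \<Rightarrow> (int \<Rightarrow>\<^sub>0 'a::field)" where
  "laurent_mon n \<equiv> Poly_Mapping.single n 1"

definition laurent_subst :: "'a::field poly \<Rightarrow> (int \<Rightarrow>\<^sub>0 'a) \<Rightarrow> (int \<Rightarrow>\<^sub>0 'a)" where
  "laurent_subst f L = poly (map_poly (Poly_Mapping.single 0) f) L"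

definition is_chebyshev :: "nat \<Rightarrow> 'a::field poly \<Rightarrow> bool" where
  "is_chebyshev d f \<longleftrightarrow>
     lead_coeff f = 1 \<and>
     laurent_subst f (laurent_mon 1 + laurent_mon (-1)) =
       laurent_mon (int d) + laurent_mon (- int d)"

text \<open>
  Only meant for \<open>d > 0\<close>: see \<open>ex1_chebyshev\<close> below. (For \<open>d = 0\<close> the
  polynomial would have to be the constant 2, which is not monic.)
\<close>

definition chebyshev :: "nat \<Rightarrow> 'a::field poly" where
  "chebyshev d = (THE f. is_chebyshev d f)"

lemma laurent_subst_simps:
  fixes f g :: "'a::field poly"
  shows "laurent_subst 0 L = 0"
    and "laurent_subst (pCons a f) L = Poly_Mapping.single 0 a + L * laurent_subst f L"
    and "laurent_subst (f + g) L = laurent_subst f L + laurent_subst g L"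
    and "laurent_subst (f - g) L = laurent_subst f L - laurent_subst g L"
proof -
  have pc: "laurent_subst (pCons a f) L = Poly_Mapping.single 0 a + L * laurent_subst f L" for a f
    by (cases "a = 0 \<and> f = 0") (auto simp: laurent_subst_def map_poly_pCons)
  show "laurent_subst 0 L = 0"
    by (simp add: laurent_subst_def)
  show "laurent_subst (pCons a f) L = Poly_Mapping.single 0 a + L * laurent_subst f L"
    by (rule pc)
  have "map_poly (Poly_Mapping.single (0::int)) (f + g) =
      map_poly (Poly_Mapping.single 0) f + map_poly (Poly_Mapping.single 0) g"
    by (rule poly_eqI) (simp add: coeff_map_poly single_add)
  then show "laurent_subst (f + g) L = laurent_subst f L + laurent_subst g L"
    by (simp add: laurent_subst_def)
  have "map_poly (Poly_Mapping.single (0::int)) (f - g) =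
      map_poly (Poly_Mapping.single 0) f - map_poly (Poly_Mapping.single 0) g"
    by (rule poly_eqI) (simp add: coeff_map_poly single_diff)
  then show "laurent_subst (f - g) L = laurent_subst f L - laurent_subst g L"
    by (simp add: laurent_subst_def)
qed

lemma lookup_laurent_mon_times:
  fixes g :: "int \<Rightarrow>\<^sub>0 'a::field"
  shows "Poly_Mapping.lookup (laurent_mon m * g) k = Poly_Mapping.lookup g (k - m)"
proof -
  have *: "(k = m + q) = (q = k - m)" for q by auto
  show ?thesis
    by (simp add: lookup_mult lookup_single when_mult *)
qed

lemma lookup_laurent_subst:
  fixes f :: "'a::field poly"
  shows "k \<ge> int (degree f) \<Longrightarrow>
    Poly_Mapping.lookup (laurent_subst f (laurent_mon 1 + laurent_mon (-1))) k =
      (if k = int (degree f) then lead_coeff f else 0)"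
proof (induction f arbitrary: k)
  case 0
  then show ?case by (simp add: laurent_subst_simps)
next
  case (pCons a f)
  show ?case
  proof (cases "f = 0")
    case True
    with pCons.prems show ?thesis
      by (auto simp: laurent_subst_simps lookup_single when_def)
  next
    case False
    then have "k \<ge> int (degree f) + 1" using pCons.prems by simp
    with pCons.IH[of "k - 1"] pCons.IH[of "k + 1"] False show ?thesis
      by (auto simp: laurent_subst_simps distrib_right lookup_add lookup_laurent_mon_times
          lookup_single when_def)
  qed
qed

lemma laurent_subst_inj:
  fixes f g :: "'a::field poly"
  assumes "laurent_subst f (laurent_mon 1 + laurent_mon (-1)) =
           laurent_subst g (laurent_mon 1 + laurent_mon (-1))"
  shows "f = g"
proof -
  have "lead_coeff (f - g) = 0"
    using lookup_laurent_subst[of "f - g" "int (degree (f - g))"] assms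
    by (simp add: laurent_subst_simps)
  then have "f - g = 0" by (simp only: leading_coeff_0_iff)
  then show ?thesis by simp
qed

fun chebyshev_rec :: "nat \<Rightarrow> 'a::field poly" where
  "chebyshev_rec 0 = [:2:]"
| "chebyshev_rec (Suc 0) = [:0, 1:]"
| "chebyshev_rec (Suc (Suc n)) = pCons 0 (chebyshev_rec (Suc n)) - chebyshev_rec n"

lemma laurent_subst_chebyshev_rec:
  "laurent_subst (chebyshev_rec n) (laurent_mon 1 + laurent_mon (-1)) =
     laurent_mon (int n) + laurent_mon (- int n)"
proof (induction n rule: chebyshev_rec.induct)
  case 1
  then show ?case by (simp add: laurent_subst_simps)
next
  case 2
  then show ?case by (simp add: laurent_subst_simps)
next
  case (3 n)
  have "- 2 - int n = - int n - 2" by simp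
  then have "(laurent_mon (- 2 - int n) :: int \<Rightarrow>\<^sub>0 'a) = laurent_mon (- int n - 2)"
    by (rule arg_cong)
  with 3 show ?case
    by (simp add: laurent_subst_simps algebra_simps mult_single)
qed

lemma chebyshev_rec_monic:
  "degree (chebyshev_rec (Suc n) :: 'a::field poly) = Suc n \<and>
   lead_coeff (chebyshev_rec (Suc n) :: 'a poly) = 1"
proof (induction n rule: less_induct)
  case (less n)
  show ?case
  proof (cases n)
    case 0
    then show ?thesis by simp
  next
    case (Suc m)
    let ?P = "pCons 0 (chebyshev_rec (Suc m)) :: 'a poly"
    let ?Q = "chebyshev_rec m :: 'a poly"
    have IH: "degree (chebyshev_rec (Suc m) :: 'a poly) = Suc m"
      "lead_coeff (chebyshev_rec (Suc m) :: 'a poly) = 1"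
      using less[of m] Suc by auto
    then have nz: "chebyshev_rec (Suc m) \<noteq> (0 :: 'a poly)" by auto
    have P: "degree ?P = Suc (Suc m)" using IH nz by simp
    have Q: "degree ?Q \<le> m"
      using less[of "m - 1"] Suc by (cases m) auto
    have D: "degree (?P - ?Q) = Suc (Suc m)"
      using P Q degree_add_eq_left[of "- ?Q" ?P] by simp
    have "coeff ?Q (Suc (Suc m)) = 0"
      using Q by (intro coeff_eq_0) simp
    then show ?thesis using IH D Suc by simp
  qed
qed

lemma ex1_chebyshev:
  assumes "d > 0"
  shows "\<exists>!f :: 'a::field poly. is_chebyshev d f"
proof (rule ex1I)
  show "is_chebyshev d (chebyshev_rec d :: 'a poly)"
    using assms chebyshev_rec_monic[of "d - 1", where ?'a = 'a]
    by (auto simp add: is_chebyshev_def laurent_subst_chebyshev_rec)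
next
  fix f :: "'a poly"
  assume "is_chebyshev d f"
  then show "f = chebyshev_rec d"
    by (intro laurent_subst_inj) (simp add: is_chebyshev_def laurent_subst_chebyshev_rec)
qed

lemma is_chebyshev_chebyshev:
  "d > 0 \<Longrightarrow> is_chebyshev d (chebyshev d :: 'a::field poly)"
  unfolding chebyshev_def by (rule theI') (rule ex1_chebyshev)


section \<open>Homogeneous polynomials and projective space\<close>

text \<open>Polynomials in variables indexed by \<open>'n\<close>: exponent vectors \<open>'n \<Rightarrow>\<^sub>0 nat\<close>.\<close>

type_synonym ('n, 'a) mpol = "('n \<Rightarrow>\<^sub>0 nat) \<Rightarrow>\<^sub>0 'a"

definition mpol_eval :: "('n::finite, 'a::field) mpol \<Rightarrow> 'a ^ 'n \<Rightarrow> 'a" where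
  "mpol_eval F v =
     (\<Sum>m\<in>Poly_Mapping.keys F.
        Poly_Mapping.lookup F m * (\<Prod>i\<in>UNIV. (v $ i) ^ Poly_Mapping.lookup m i))"

definition homogeneous :: "nat \<Rightarrow> ('n::finite, 'a::field) mpol \<Rightarrow> bool" where
  "homogeneous e F \<longleftrightarrow>
     (\<forall>m\<in>Poly_Mapping.keys F. (\<Sum>i\<in>UNIV. Poly_Mapping.lookup m i) = e)"

text \<open>A point of projective space is the set of all its vectors of homogeneous coordinates.\<close>

definition proj_point :: "'a::field ^ 'n::finite \<Rightarrow> ('a ^ 'n) set" where
  "proj_point v = {c *s v | c. c \<noteq> 0}"

definition proj_space :: "('a::field ^ 'n::finite) set set" where
  "proj_space = proj_point ` {v. v \<noteq> 0}"

definition vanishes_at :: "('n::finite, 'a::field) mpol \<Rightarrow> ('a ^ 'n) set \<Rightarrow> bool" where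
  "vanishes_at F P \<longleftrightarrow> (\<forall>v\<in>P. mpol_eval F v = 0)"

definition zariski_closure :: "('a::field ^ 'n::finite) set set \<Rightarrow> ('a ^ 'n) set set" where
  "zariski_closure S =
     {P \<in> proj_space. \<forall>e F. homogeneous e F \<longrightarrow> (\<forall>Q\<in>S. vanishes_at F Q) \<longrightarrow> vanishes_at F P}"

definition plane_closure :: "('a::field \<times> 'a) set \<Rightarrow> ('a ^ 3) set set" where
  "plane_closure A = zariski_closure ((\<lambda>(x, y). proj_point (vector [x, y, 1])) ` A)"


section \<open>Isomorphism over a field of definition\<close>

text \<open>
  Varieties over \<open>'k\<close> are represented by their points over the algebraic closure of \<open>'k\<close>.
  A morphism over \<open>'k\<close> is a map that, around every point, is given by forms of equal degree with
  coefficients in \<open>'k\<close>. The open set on which such a local expression is valid may be taken to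
  be the whole locus where the forms do not vanish simultaneously: if they represent the map only on
  the complement of the zero locus of a form \<open>G\<close>, multiply all of them by \<open>G\<close>.
\<close>

definition base_change :: "('n, 'k::field) mpol \<Rightarrow> ('n, 'k alg_closure) mpol" where
  "base_change F = Poly_Mapping.map to_ac F"

definition morphism_over ::
  "'k::field itself \<Rightarrow> ('k alg_closure ^ 'n::finite) set set \<Rightarrow>
     ('k alg_closure ^ 'm::finite) set set \<Rightarrow>
     (('k alg_closure ^ 'n) set \<Rightarrow> ('k alg_closure ^ 'm) set) \<Rightarrow> bool" where
  "morphism_over K V W f \<longleftrightarrow>
     f ` V \<subseteq> W \<and>
     (\<forall>P\<in>V. \<exists>e (F :: 'm \<Rightarrow> ('n, 'k) mpol).
        (\<forall>i. homogeneous e (F i)) \<and>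
        (\<exists>i. \<not> vanishes_at (base_change (F i)) P) \<and>
        (\<forall>Q\<in>V. \<forall>v\<in>Q.
           (\<chi> i. mpol_eval (base_change (F i)) v) \<noteq> 0 \<longrightarrow>
           f Q = proj_point (\<chi> i. mpol_eval (base_change (F i)) v)))"

definition isomorphic_over ::
  "'k::field itself \<Rightarrow> ('k alg_closure ^ 'n::finite) set set \<Rightarrow>
     ('k alg_closure ^ 'm::finite) set set \<Rightarrow> bool" where
  "isomorphic_over K V W \<longleftrightarrow>
     (\<exists>f g. morphism_over K V W f \<and> morphism_over K W V g \<and>
        (\<forall>P\<in>V. g (f P) = P) \<and> (\<forall>Q\<in>W. f (g Q) = Q))"


section \<open>The two curves\<close>

definition chebyshev_curve :: "'k::field itself \<Rightarrow> nat \<Rightarrow> ('k alg_closure ^ 3) set set" where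
  "chebyshev_curve K d =
     plane_closure {(x, y). y ^ d = poly (map_poly to_ac (chebyshev d :: 'k poly)) x}"

definition fermat_curve :: "'k::field itself \<Rightarrow> nat \<Rightarrow> ('k alg_closure ^ 3) set set" where
  "fermat_curve K d = plane_closure {(u, v). v ^ d = u ^ d + 1}"

end

theory Submission
  imports Defs "HOL-Number_Theory.Residues"
begin

unbundle no Formal_Power_Series.fps_syntax

text \<open>
  Substituting \<open>x = s\<^sup>2 + s\<inverse>\<^sup>2\<close> and applying Frobenius to \<open>(s \<plusminus> s\<inverse>)\<^sup>q\<^sup>+\<^sup>1\<close> gives
  \<open>2 \<phi>\<^sub>d(x) = (x + 2)\<^sup>d + (x - 2)\<^sup>d\<close>. Hence \<open>(X : Y : Z) \<mapsto> (X + 2Z : cY : X - 2Z)\<close> with \<open>c\<^sup>d = 2\<close> carries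
  the homogeneous Chebyshev equation to the Fermat equation. Such a \<open>c\<close> lies in the field with
  \<open>q\<^sup>2\<close> elements because \<open>q\<^sup>2 - 1 = 2d(q - 1)\<close> and \<open>2\<close> is fixed by Frobenius. Since this map does
  not respect the affine parts, each projective closure must first be identified with the full zero
  locus of its homogeneous equation: a form vanishing on the affine part reduces modulo \<open>y\<^sup>d - r(t)\<close>
  to a polynomial of degree less than \<open>d\<close> in \<open>y\<close>, which is zero because generic fibres have \<open>d\<close>
  points.
\<close>

section \<open>Algebraically closed fields and finite fields\<close>

text \<open>If the field were finite, 1 plus the product of all \<open>[:-x, 1:]\<close> would take
  the value 1 everywhere, yet it has positive degree and so a root.\<close>

lemma infinite_UNIV_alg_closed: "infinite (UNIV :: 'a::alg_closed_field set)"
proof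
  assume fin: "finite (UNIV :: 'a set)"
  define p :: "'a poly" where "p = (\<Prod>x\<in>UNIV. [:-x, 1:])"
  have "poly p x = 0" for x
    using fin by (auto simp: p_def poly_prod)
  moreover have "degree p = card (UNIV :: 'a set)"
    unfolding p_def by (subst degree_prod_eq_sum_degree) auto
  then have "degree p > 0"
    using fin by (simp add: finite_UNIV_card_ge_0)
  then have "degree (p + 1) > 0"
    by (subst degree_add_eq_left) auto
  then obtain x where "poly (p + 1) x = 0"
    using alg_closed_imp_poly_has_root by blast
  ultimately show False by simp
qed

text \<open>Split off one linear factor and induct on the degree. By the product rule the derivative
  of \<open>p\<close> at \<open>x\<close> equals \<open>poly r x\<close>, so \<open>x\<close> is not
  a root of the cofactor \<open>r\<close>, and the roots of \<open>r\<close> stay simple.\<close>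

lemma card_roots_separable:
  fixes p :: "'a::alg_closed_field poly"
  assumes "p \<noteq> 0" and "\<And>x. poly p x = 0 \<Longrightarrow> poly (pderiv p) x \<noteq> 0"
  shows "card {x. poly p x = 0} = degree p"
  using assms
proof (induction "degree p" arbitrary: p)
  case 0
  then show ?case
    by (auto elim!: degree_eq_zeroE)
next
  case (Suc n)
  obtain x where x: "poly p x = 0"
    using alg_closed_imp_poly_has_root[of p] Suc.hyps(2) by auto
  then obtain r where r: "p = [:-x, 1:] * r"
    by (auto simp: poly_eq_0_iff_dvd)
  have "r \<noteq> 0" using Suc.prems(1) r by auto
  then have deg: "degree p = Suc (degree r)"
    unfolding r by (subst degree_mult_eq) auto
  have pd: "poly (pderiv p) y = poly r y + (y - x) * poly (pderiv r) y" for y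
    unfolding r pderiv_mult by (simp add: pderiv_pCons algebra_simps)
  have rx: "poly r x \<noteq> 0"
    using Suc.prems(2)[OF x] pd[of x] by auto
  have "card {y. poly r y = 0} = degree r"
  proof (rule Suc.hyps(1))
    fix y assume "poly r y = 0"
    then show "poly (pderiv r) y \<noteq> 0"
      using Suc.prems(2)[of y] pd[of y] r by auto
  qed (use deg Suc.hyps(2) \<open>r \<noteq> 0\<close> in auto)
  moreover have "{y. poly p y = 0} = insert x {y. poly r y = 0}"
    using r by auto
  ultimately show ?case
    using deg rx poly_roots_finite[OF \<open>r \<noteq> 0\<close>] by simp
qed

lemma card_nth_roots_alg_closed:
  fixes a :: "'a::alg_closed_field"
  assumes "a \<noteq> 0" and "d > 0" and "of_nat d \<noteq> (0 :: 'a)"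
  shows "card {y. y ^ d = a} = d"
proof -
  define p where "p = monom 1 d - [:a:]"
  have deg: "degree p = d"
    unfolding p_def diff_conv_add_uminus
    by (subst degree_add_eq_left) (use \<open>d > 0\<close> in \<open>auto simp: degree_monom_eq\<close>)
  have root: "poly p x = 0 \<longleftrightarrow> x ^ d = a" for x
    by (simp add: p_def poly_monom)
  \<comment> \<open>Roots are nonzero because \<open>a\<close> is, so this derivative vanishes at
    none of them as long as the characteristic does not divide \<open>d\<close>.\<close>
  have "poly (pderiv p) x = of_nat d * x ^ (d - 1)" for x
    by (simp add: p_def pderiv_diff pderiv_monom poly_monom pderiv_pCons)
  moreover have "x \<noteq> 0" if "x ^ d = a" for x
    using that assms by (auto simp: zero_power)
  ultimately have "card {y. poly p y = 0} = degree p"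
    using deg assms by (intro card_roots_separable) (auto simp: root)
  then show ?thesis
    by (simp only: root deg)
qed

section \<open>Finite fields and their characteristic\<close>

lemma finite_field_power_CARD:
  fixes x :: "'a::{field, finite}"
  shows "x ^ CARD('a) = x"
proof (cases "x = 0")
  case False
  \<comment> \<open>Multiplication by \<open>x\<close> permutes the nonzero elements. The extra
    factor \<open>x\<close> raises the exponent from \<open>CARD('a) - 1\<close> to
    \<open>CARD('a)\<close>.\<close>
  have "x * (\<Prod>y\<in>UNIV-{0}. x * y) = x * x ^ (CARD('a) - 1) * \<Prod>(UNIV-{0})"
    by (simp add: prod.distrib mult_ac)
  also have "x * x ^ (CARD('a) - 1) = x ^ Suc (CARD('a) - 1)"
    by (simp only: power_Suc)
  also have "(\<Prod>y\<in>UNIV-{0}. x * y) = (\<Prod>y\<in>UNIV-{0}. y)"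
    by (rule prod.reindex_bij_witness[of _ "\<lambda>y. y / x" "\<lambda>y. x * y"]) (use False in auto)
  also have "Suc (CARD('a) - 1) = CARD('a)"
    by simp
  finally show ?thesis
    by simp
qed (simp add: zero_power)

text \<open>Descent to the base field: X^N - X with N = \<open>CARD('k)\<close> has at most N roots
  in the closure, and the image of \<open>'k\<close> already supplies N of them.\<close>

lemma range_to_ac_finite:
  fixes c :: "'k::{field, finite} alg_closure"
  assumes "c ^ CARD('k) = c"
  shows "c \<in> range (to_ac :: 'k \<Rightarrow> _)"
proof -
  define p :: "'k alg_closure poly" where "p = monom 1 CARD('k) - monom 1 1"
  have "card {0 :: 'k, 1} \<le> CARD('k)"
    by (rule card_mono) auto
  then have gt: "CARD('k) > 1" by simp
  have deg: "degree p = CARD('k)"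
    unfolding p_def diff_conv_add_uminus
    by (subst degree_add_eq_left) (use gt in \<open>auto simp: degree_monom_eq\<close>)
  have "p \<noteq> 0" using deg gt by auto
  have root: "poly p x = 0 \<longleftrightarrow> x ^ CARD('k) = x" for x
    by (simp add: p_def poly_monom)
  have "range (to_ac :: 'k \<Rightarrow> _) = {x. poly p x = 0}"
  proof (rule card_seteq)
    show "range (to_ac :: 'k \<Rightarrow> _) \<subseteq> {x. poly p x = 0}"
      by (auto simp: root finite_field_power_CARD simp flip: to_ac_power)
    show "card {x. poly p x = 0} \<le> card (range (to_ac :: 'k \<Rightarrow> _))"
      using card_poly_roots_bound[OF \<open>p \<noteq> 0\<close>] deg by (simp add: card_image inj_to_ac)
  qed (use poly_roots_finite[OF \<open>p \<noteq> 0\<close>] in auto)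
  then show ?thesis using assms root by blast
qed

lemma CHAR_of_CARD_prime_power:
  assumes "prime p" and "CARD('k::{field, finite}) = p ^ n"
  shows "CHAR('k) = p"
proof -
  have "prime CHAR('k)"
    by (rule prime_CHAR_semidom) (simp add: finite_imp_CHAR_pos)
  moreover have "CHAR('k) dvd p ^ n"
    using CHAR_dvd_CARD[where ?'a = 'k] assms(2) by simp
  ultimately show ?thesis
    using assms(1) prime_dvd_power primes_dvd_imp_eq by blast
qed

section \<open>Evaluation of forms\<close>

text \<open>Allows polynomials with different supports to be evaluated over one common index set;
  the support of a sum may shrink through cancellation.\<close>

lemma mpol_eval_superset:
  assumes "finite M" and "Poly_Mapping.keys F \<subseteq> M"
  shows "mpol_eval F v =
    (\<Sum>m\<in>M. Poly_Mapping.lookup F m * (\<Prod>i\<in>UNIV. (v $ i) ^ Poly_Mapping.lookup m i))"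
  unfolding mpol_eval_def using assms
  by (intro sum.mono_neutral_left) (auto simp: in_keys_iff)

lemma mpol_eval_0 [simp]: "mpol_eval 0 v = 0"
  by (simp add: mpol_eval_def)

lemma mpol_eval_add: "mpol_eval (F + G) v = mpol_eval F v + mpol_eval G v"
  by (simp add: mpol_eval_superset[of "Poly_Mapping.keys F \<union> Poly_Mapping.keys G"]
      Poly_Mapping.keys_add lookup_add distrib_right sum.distrib)

lemma mpol_eval_sum: "mpol_eval (\<Sum>a\<in>A. F a) v = (\<Sum>a\<in>A. mpol_eval (F a) v)"
  by (induction A rule: infinite_finite_induct) (simp_all add: mpol_eval_add)

lemma mpol_eval_single:
  "mpol_eval (Poly_Mapping.single m c) v = c * (\<Prod>i\<in>UNIV. (v $ i) ^ Poly_Mapping.lookup m i)"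
  by (simp add: mpol_eval_superset[of "{m}"])

lemma homogeneous_0: "homogeneous e 0"
  by (simp add: homogeneous_def)

lemma homogeneous_add: "homogeneous e F \<Longrightarrow> homogeneous e G \<Longrightarrow> homogeneous e (F + G)"
  unfolding homogeneous_def using Poly_Mapping.keys_add[of F G] by (metis Un_iff subsetD)

lemma homogeneous_sum: "(\<And>a. a \<in> A \<Longrightarrow> homogeneous e (F a)) \<Longrightarrow> homogeneous e (\<Sum>a\<in>A. F a)"
  by (induction A rule: infinite_finite_induct) (simp_all add: homogeneous_add homogeneous_0)

lemma homogeneous_single:
  "(\<Sum>i\<in>UNIV. Poly_Mapping.lookup m i) = e \<Longrightarrow> homogeneous e (Poly_Mapping.single m c)"
  by (simp add: homogeneous_def)

lemma lookup_base_change: "Poly_Mapping.lookup (base_change F) m = to_ac (Poly_Mapping.lookup F m)"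
  by (simp add: base_change_def Poly_Mapping.map.rep_eq when_def)

lemma base_change_0: "base_change 0 = 0"
  by (rule poly_mapping_eqI) (simp add: lookup_base_change)

lemma base_change_add: "base_change (F + G) = base_change F + base_change G"
  by (rule poly_mapping_eqI) (simp add: lookup_base_change lookup_add)

lemma base_change_sum: "base_change (\<Sum>a\<in>A. F a) = (\<Sum>a\<in>A. base_change (F a))"
  by (induction A rule: infinite_finite_induct) (simp_all add: base_change_add base_change_0)

lemma base_change_single: "base_change (Poly_Mapping.single m c) = Poly_Mapping.single m (to_ac c)"
  by (simp add: base_change_def)

lemma mpol_eval_scale:
  assumes "homogeneous e F"
  shows "mpol_eval F (c *s v) = c ^ e * mpol_eval F v"
proof -
  have "(\<Prod>i\<in>UNIV. (c * v $ i) ^ Poly_Mapping.lookup m i) =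
      c ^ e * (\<Prod>i\<in>UNIV. (v $ i) ^ Poly_Mapping.lookup m i)"
    if "m \<in> Poly_Mapping.keys F" for m
    using assms that
    by (simp add: homogeneous_def power_mult_distrib prod.distrib flip: power_sum)
  then show ?thesis
    by (simp add: mpol_eval_def sum_distrib_left mult_ac)
qed

section \<open>Projective points and their homogeneous coordinates\<close>

lemma mem_proj_point_self: "v \<in> proj_point v"
  unfolding proj_point_def by (auto intro!: exI[of _ 1])

lemma vanishes_at_proj_point:
  assumes "homogeneous e F"
  shows "vanishes_at F (proj_point v) \<longleftrightarrow> mpol_eval F v = 0"
proof
  assume "vanishes_at F (proj_point v)"
  then show "mpol_eval F v = 0"
    using mem_proj_point_self by (auto simp: vanishes_at_def)
next
  assume "mpol_eval F v = 0"
  then show "vanishes_at F (proj_point v)"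
    by (auto simp: vanishes_at_def proj_point_def mpol_eval_scale[OF assms])
qed

lemma proj_point_scale:
  assumes "c \<noteq> 0"
  shows "proj_point (c *s v) = proj_point v"
proof (intro equalityI subsetI)
  fix w assume "w \<in> proj_point v"
  then obtain a where "w = a *s v" "a \<noteq> 0"
    by (auto simp: proj_point_def)
  then have "w = (a / c) *s (c *s v)" "a / c \<noteq> 0"
    using assms by (auto simp: vector_smult_assoc)
  then show "w \<in> proj_point (c *s v)"
    unfolding proj_point_def by blast
next
  fix w assume "w \<in> proj_point (c *s v)"
  then obtain a where "w = (a * c) *s v" "a * c \<noteq> 0"
    using assms by (auto simp: proj_point_def vector_smult_assoc)
  then show "w \<in> proj_point v"
    unfolding proj_point_def by blast
qed

lemma proj_point_eq_of_mem:
  assumes "w \<in> proj_point v"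
  shows "proj_point w = proj_point v"
proof -
  obtain c where "w = c *s v" "c \<noteq> 0"
    using assms by (auto simp: proj_point_def)
  then show ?thesis
    by (simp add: proj_point_scale)
qed

section \<open>Linear isomorphisms\<close>

definition linear_form :: "('k::field ^ 'n::finite) \<Rightarrow> ('n, 'k) mpol" where
  "linear_form a = (\<Sum>j\<in>UNIV. Poly_Mapping.single (Poly_Mapping.single j 1) (a $ j))"

lemma homogeneous_linear_form: "homogeneous 1 (linear_form a)"
  unfolding linear_form_def
  by (intro homogeneous_sum homogeneous_single) (simp add: lookup_single when_def)

lemma mpol_eval_linear_form:
  "mpol_eval (base_change (linear_form a)) v = (\<Sum>j\<in>UNIV. to_ac (a $ j) * v $ j)"
proof -
  have "(\<Prod>i\<in>UNIV. v $ i ^ Poly_Mapping.lookup (Poly_Mapping.single j 1) i) = v $ j" for j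
    by (simp add: lookup_single when_def if_distrib[where f = "\<lambda>n. _ ^ n"] cong: if_cong)
  then show ?thesis
    by (simp add: linear_form_def base_change_sum base_change_single mpol_eval_sum
        mpol_eval_single)
qed

definition matrix_to_ac :: "'k::field ^ 'n ^ 'm \<Rightarrow> 'k alg_closure ^ 'n ^ 'm" where
  "matrix_to_ac A = (\<chi> i j. to_ac (A $ i $ j))"

lemma matrix_to_ac_mult: "matrix_to_ac (A ** B) = matrix_to_ac A ** matrix_to_ac B"
  by (simp add: matrix_to_ac_def matrix_matrix_mult_def vec_eq_iff to_ac_sum)

lemma matrix_to_ac_mat_1: "matrix_to_ac (mat 1) = mat 1"
  by (simp add: matrix_to_ac_def mat_def vec_eq_iff)

lemma proj_point_altdef: "proj_point v = (\<lambda>c. c *s v) ` (- {0})"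
  by (auto simp: proj_point_def)

lemma image_matrix_proj_point:
  fixes E :: "'a::field ^ 'n ^ 'm"
  shows "(*v) E ` proj_point v = proj_point (E *v v)"
  by (simp add: proj_point_altdef image_image vector_scalar_commute)

text \<open>The rows of \<open>A\<close> give a single tuple of linear forms over \<open>'k\<close>
  that serves at every point, since injectivity over the closure excludes a common zero in
  projective space.\<close>

lemma morphism_over_linear:
  fixes A :: "'k::field ^ 'n ^ 'm"
  assumes V: "V \<subseteq> proj_space" and VW: "(\<lambda>P. (*v) (matrix_to_ac A) ` P) ` V \<subseteq> W"
    and inj: "\<And>v. matrix_to_ac A *v v = 0 \<Longrightarrow> v = 0"
  shows "morphism_over TYPE('k) V W (\<lambda>P. (*v) (matrix_to_ac A) ` P)"
proof -
  define F where "F i = linear_form (A $ i)" for i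
  have ev: "(\<chi> i. mpol_eval (base_change (F i)) v) = matrix_to_ac A *v v" for v
    by (simp add: F_def mpol_eval_linear_form matrix_to_ac_def matrix_vector_mult_def)
  have 1: "\<exists>i. \<not> vanishes_at (base_change (F i)) P" if "P \<in> V" for P
  proof -
    obtain v where v: "v \<noteq> 0" "P = proj_point v"
      using \<open>P \<in> V\<close> V by (auto simp: proj_space_def)
    then have "(\<chi> i. mpol_eval (base_change (F i)) v) \<noteq> 0"
      using inj ev by metis
    then have "\<exists>i. mpol_eval (base_change (F i)) v \<noteq> 0"
      by (auto simp: vec_eq_iff)
    then show ?thesis
      using v mem_proj_point_self[of v] by (auto simp: vanishes_at_def)
  qed
  have 2: "(*v) (matrix_to_ac A) ` Q = proj_point (matrix_to_ac A *v v)"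
    if "Q \<in> V" "v \<in> Q" for Q v
  proof -
    obtain u where "Q = proj_point u"
      using \<open>Q \<in> V\<close> V by (auto simp: proj_space_def)
    then show ?thesis
      using \<open>v \<in> Q\<close> proj_point_eq_of_mem image_matrix_proj_point by metis
  qed
  have "homogeneous 1 (F i)" for i
    by (simp only: F_def homogeneous_linear_form)
  then show ?thesis
    unfolding morphism_over_def using VW 1 2
    by (intro conjI ballI exI[of _ 1] exI[of _ F]) (auto simp: ev)
qed

text \<open>Both matrices have entries in \<open>'k\<close>, so both directions are defined over
  \<open>'k\<close>. That \<open>B\<close> maps \<open>W\<close> back into \<open>V\<close> follows
  from \<open>PQ\<close> at \<open>?B *v v\<close>, because
  \<open>?A *v (?B *v v) = v\<close>.\<close>

lemma isomorphic_over_linear: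
  fixes A B :: "'k::field ^ 'n ^ 'n"
  assumes AB: "A ** B = mat 1" and BA: "B ** A = mat 1"
    and V: "V = {proj_point v | v. v \<noteq> 0 \<and> P v}"
    and W: "W = {proj_point v | v. v \<noteq> 0 \<and> Q v}"
    and PQ: "\<And>v. P v \<longleftrightarrow> Q (matrix_to_ac A *v v)"
  shows "isomorphic_over TYPE('k) V W"
proof -
  let ?A = "matrix_to_ac A" and ?B = "matrix_to_ac B"
  have ab: "?A *v (?B *v v) = v" and ba: "?B *v (?A *v v) = v" for v
    by (simp_all add: matrix_vector_mul_assoc AB BA matrix_to_ac_mat_1
        flip: matrix_to_ac_mult)
  have inj: "?A *v v = 0 \<Longrightarrow> v = 0" "?B *v v = 0 \<Longrightarrow> v = 0" for v
    using ab[of v] ba[of v] by auto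
  have "morphism_over TYPE('k) V W (\<lambda>P. (*v) ?A ` P)"
  proof (rule morphism_over_linear[OF _ _ inj(1)])
    show "(\<lambda>P. (*v) ?A ` P) ` V \<subseteq> W"
      using inj(1) PQ unfolding V W by (fastforce simp: image_matrix_proj_point)
  qed (auto simp: V proj_space_def)
  moreover have "morphism_over TYPE('k) W V (\<lambda>P. (*v) ?B ` P)"
  proof (rule morphism_over_linear[OF _ _ inj(2)])
    show "(\<lambda>P. (*v) ?B ` P) ` W \<subseteq> V"
      using inj(2) PQ ab unfolding V W by (fastforce simp: image_matrix_proj_point)
  qed (auto simp: W proj_space_def)
  ultimately show ?thesis
    unfolding isomorphic_over_def
    by (intro exI[of _ "\<lambda>P. (*v) ?A ` P"] exI[of _ "\<lambda>P. (*v) ?B ` P"])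
      (simp add: image_image ab ba)
qed

section \<open>Superelliptic curves\<close>

text \<open>For \<open>f\<close> of degree \<open>d\<close> this is z^d f(x/z), written without
  division so that it also makes sense at infinity, where z = 0.\<close>

definition homogenization :: "nat \<Rightarrow> 'a::field poly \<Rightarrow> 'a \<Rightarrow> 'a \<Rightarrow> 'a" where
  "homogenization d f x z = (\<Sum>i\<le>d. coeff f i * x ^ i * z ^ (d - i))"

lemma homogenization_nonzero:
  assumes "degree f = d" and "z \<noteq> 0"
  shows "homogenization d f x z = z ^ d * poly f (x / z)"
proof -
  have *: "z ^ d * (coeff f i * (x / z) ^ i) = coeff f i * x ^ i * z ^ (d - i)" if "i \<le> d" for i
    using that assms(2) by (simp add: power_diff power_divide)
  then show ?thesis
    unfolding homogenization_def poly_altdef assms(1) sum_distrib_left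
    by (intro sum.cong refl) (simp only: * atMost_iff)
qed

lemma homogenization_0: "homogenization d f x 0 = coeff f d * x ^ d"
proof -
  have "homogenization d f x 0 = (\<Sum>i\<in>{d}. coeff f i * x ^ i * 0 ^ (d - i))"
    unfolding homogenization_def by (intro sum.mono_neutral_right) auto
  then show ?thesis by simp
qed

lemma prod_UNIV_3: "prod f (UNIV :: 3 set) = f 1 * f 2 * f 3"
  unfolding UNIV_3 by (simp add: ac_simps)

definition superelliptic_form :: "nat \<Rightarrow> 'a::field poly \<Rightarrow> (3, 'a) mpol" where
  "superelliptic_form d f =
     Poly_Mapping.single (Poly_Mapping.single 2 d) 1 +
     (\<Sum>i\<le>d. Poly_Mapping.single (Poly_Mapping.single 1 i + Poly_Mapping.single 3 (d - i)) (- coeff f i))"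

lemma homogeneous_superelliptic_form: "homogeneous d (superelliptic_form d f)"
  unfolding superelliptic_form_def
  by (intro homogeneous_add homogeneous_sum homogeneous_single)
    (simp_all add: sum_3 lookup_add lookup_single when_def)

lemma mpol_eval_superelliptic_form:
  "mpol_eval (superelliptic_form d f) v = (v $ 2) ^ d - homogenization d f (v $ 1) (v $ 3)"
  by (simp add: superelliptic_form_def homogenization_def mpol_eval_add mpol_eval_sum
      mpol_eval_single prod_UNIV_3 lookup_add lookup_single when_def sum_negf mult.assoc)

section \<open>Forms restricted to the curve y^d = r(t) in the chart X = 1\<close>

lemma mpol_eval_on_fiber:
  fixes F :: "(3, 'a::field) mpol"
  assumes "d > 0"
  obtains g :: "nat \<Rightarrow> 'a poly"
  where "\<And>t y. y ^ d = poly r t \<Longrightarrow> mpol_eval F (vector [1, y, t]) = (\<Sum>i<d. poly (g i) t * y ^ i)"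
proof
  \<comment> \<open>Dividing the exponent of y by \<open>d\<close> with remainder replaces each full
    block y^d by \<open>r\<close>. So \<open>h m\<close> is what the monomial \<open>m\<close>
    contributes to the coefficient of y to the remainder; its power of X is 1 in this chart.\<close>
  define h where "h m = smult (Poly_Mapping.lookup F m)
    (r ^ (Poly_Mapping.lookup m 2 div d) * monom 1 (Poly_Mapping.lookup m 3))" for m :: "3 \<Rightarrow>\<^sub>0 nat"
  let ?K = "Poly_Mapping.keys F"
  let ?g = "\<lambda>i. \<Sum>m | m \<in> ?K \<and> Poly_Mapping.lookup m 2 mod d = i. h m"
  fix t y :: 'a
  assume y: "y ^ d = poly r t"
  have mon: "Poly_Mapping.lookup F m * (\<Prod>i\<in>UNIV. (vector [1, y, t] :: 'a ^ 3) $ i ^ Poly_Mapping.lookup m i) =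
      poly (h m) t * y ^ (Poly_Mapping.lookup m 2 mod d)" for m
  proof -
    have "y ^ Poly_Mapping.lookup m 2 =
        y ^ (d * (Poly_Mapping.lookup m 2 div d) + Poly_Mapping.lookup m 2 mod d)"
      by simp
    also have "\<dots> = poly r t ^ (Poly_Mapping.lookup m 2 div d) * y ^ (Poly_Mapping.lookup m 2 mod d)"
      by (simp only: power_add power_mult y)
    finally show ?thesis
      by (simp add: h_def prod_UNIV_3 poly_monom)
  qed
  have "(\<Sum>i<d. poly (?g i) t * y ^ i) =
      (\<Sum>i<d. \<Sum>m | m \<in> ?K \<and> Poly_Mapping.lookup m 2 mod d = i.
        poly (h m) t * y ^ (Poly_Mapping.lookup m 2 mod d))"
    by (simp add: poly_sum sum_distrib_right)
  also have "\<dots> = (\<Sum>m\<in>?K. poly (h m) t * y ^ (Poly_Mapping.lookup m 2 mod d))"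
    by (rule sum.group) (use assms in auto)
  finally show "mpol_eval F (vector [1, y, t]) = (\<Sum>i<d. poly (?g i) t * y ^ i)"
    by (simp add: mpol_eval_def mon)
qed

text \<open>Over a fixed \<open>t\<close> with \<open>t\<close> and \<open>poly r t\<close> nonzero,
  a polynomial in y of degree below \<open>d\<close> vanishes at \<open>d\<close> distinct points,
  so all its coefficients vanish at that \<open>t\<close>.\<close>

lemma coefficients_vanish_on_fibers:
  fixes g :: "nat \<Rightarrow> 'a::alg_closed_field poly"
  assumes d: "d > 0" "of_nat d \<noteq> (0 :: 'a)" and "r \<noteq> 0"
    and vanish: "\<And>t y. t \<noteq> 0 \<Longrightarrow> y ^ d = poly r t \<Longrightarrow> (\<Sum>i<d. poly (g i) t * y ^ i) = 0"
    and "i < d"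
  shows "g i = 0"
proof -
  have "poly (g i) t = 0" if t: "t \<noteq> 0" "poly r t \<noteq> 0" for t
  proof -
    define p where "p = (\<Sum>j<d. monom (poly (g j) t) j)"
    have p: "poly p y = (\<Sum>j<d. poly (g j) t * y ^ j)" for y
      by (simp add: p_def poly_sum poly_monom)
    have "p = 0"
    proof (rule ccontr)
      assume "p \<noteq> 0"
      have "card {y. y ^ d = poly r t} \<le> card {y. poly p y = 0}"
        using t vanish poly_roots_finite[OF \<open>p \<noteq> 0\<close>] by (intro card_mono) (auto simp: p)
      also have "\<dots> \<le> degree p"
        by (rule card_poly_roots_bound[OF \<open>p \<noteq> 0\<close>])
      also have "degree p < d"
        unfolding p_def by (rule degree_sum_less) (use d in \<open>auto intro: le_less_trans[OF degree_monom_le]\<close>)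
      finally show False
        using card_nth_roots_alg_closed[OF t(2) d] by simp
    qed
    then have "coeff p i = 0" by simp
    then show ?thesis
      using \<open>i < d\<close> by (simp add: p_def coeff_sum)
  qed
  \<comment> \<open>The factors \<open>r\<close> and \<open>[:0, 1:]\<close> take care of the
    excluded values of \<open>t\<close>, so the product vanishes on an infinite field.\<close>
  then have "{t. poly (g i * r * [:0, 1:]) t = 0} = UNIV"
    by auto
  then have "g i * r * [:0, 1:] = 0"
    using poly_roots_finite infinite_UNIV_alg_closed by metis
  then show ?thesis
    using \<open>r \<noteq> 0\<close> by auto
qed

text \<open>Extends vanishing from \<open>t \<noteq> 0\<close> to \<open>t = 0\<close>: the
  coefficients are zero as polynomials, hence also at 0. In the chart X = 1 this passes from affine
  points to points at infinity.\<close>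

lemma vanishes_on_closed_fibers:
  fixes F :: "(3, 'a::alg_closed_field) mpol"
  assumes "d > 0" and "of_nat d \<noteq> (0 :: 'a)" and "r \<noteq> 0"
    and "\<And>t y. t \<noteq> 0 \<Longrightarrow> y ^ d = poly r t \<Longrightarrow> mpol_eval F (vector [1, y, t]) = 0"
    and "y ^ d = poly r t"
  shows "mpol_eval F (vector [1, y, t]) = 0"
proof -
  obtain g where g: "\<And>t y. y ^ d = poly r t \<Longrightarrow>
      mpol_eval F (vector [1, y, t]) = (\<Sum>i<d. poly (g i) t * y ^ i)"
    using mpol_eval_on_fiber[OF \<open>d > 0\<close>] by blast
  have "g i = 0" if "i < d" for i
    using coefficients_vanish_on_fibers[OF assms(1-3) _ that] assms(4) g by simp
  then show ?thesis
    using g[OF assms(5)] by simp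
qed

text \<open>The closure lies in the zero locus because \<open>superelliptic_form d f\<close>
  vanishes on the affine part. Conversely, zeros with nonzero third coordinate are affine points of
  the curve, and those at infinity are limits in the chart X = 1.\<close>

lemma plane_closure_superelliptic:
  fixes f :: "'a::alg_closed_field poly"
  assumes d: "d > 0" "of_nat d \<noteq> (0 :: 'a)" and f: "degree f = d" "lead_coeff f = 1"
  shows "plane_closure {(x, y). y ^ d = poly f x} =
    {proj_point v | v. v \<noteq> 0 \<and> (v $ 2) ^ d = homogenization d f (v $ 1) (v $ 3)}"
    (is "plane_closure ?A = ?C")
proof (intro equalityI subsetI)
  fix P assume P: "P \<in> plane_closure ?A"
  then obtain v where v: "v \<noteq> 0" "P = proj_point v"
    by (auto simp: plane_closure_def zariski_closure_def proj_space_def)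
  have "vanishes_at (superelliptic_form d f) (proj_point (vector [x, y, 1]))"
    if "y ^ d = poly f x" for x y
    using that by (simp add: vanishes_at_proj_point[OF homogeneous_superelliptic_form]
        mpol_eval_superelliptic_form homogenization_nonzero f(1))
  then have "vanishes_at (superelliptic_form d f) P"
    using P homogeneous_superelliptic_form by (fastforce simp: plane_closure_def zariski_closure_def)
  then show "P \<in> ?C"
    using v by (auto simp: vanishes_at_proj_point[OF homogeneous_superelliptic_form]
        mpol_eval_superelliptic_form)
next
  fix P assume "P \<in> ?C"
  then obtain v where v: "v \<noteq> 0" "P = proj_point v"
    and eq: "(v $ 2) ^ d = homogenization d f (v $ 1) (v $ 3)"
    by auto
  have "vanishes_at F P" if F: "homogeneous e F"
    and van: "\<And>x y. y ^ d = poly f x \<Longrightarrow> vanishes_at F (proj_point (vector [x, y, 1]))" for e F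
  proof (cases "v $ 3 = 0")
    case False
    then have "v = v $ 3 *s vector [v $ 1 / v $ 3, v $ 2 / v $ 3, 1]"
      by (simp add: vec_eq_iff forall_3)
    then have "P = proj_point (vector [v $ 1 / v $ 3, v $ 2 / v $ 3, 1])"
      using False v(2) proj_point_scale by metis
    moreover have "(v $ 2 / v $ 3) ^ d = poly f (v $ 1 / v $ 3)"
      using eq False by (simp add: homogenization_nonzero f(1) power_divide)
    ultimately show ?thesis
      using van by simp
  next
    case True
    txt \<open>In the chart \<open>X = 1\<close> the curve is \<open>y\<^sup>d = t\<^sup>d f(1 / t)\<close>, the right-hand side being the reflected polynomial.\<close>
    have inf: "(v $ 2) ^ d = (v $ 1) ^ d"
      using eq f True by (simp add: homogenization_0)
    \<comment> \<open>Since \<open>f\<close> is monic of degree \<open>d\<close>, the point (0 : 1 :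
      0) is not on the curve, so the chart X = 1 contains all its points at infinity.\<close>
    have v1: "v $ 1 \<noteq> 0"
    proof
      assume "v $ 1 = 0"
      then have "v $ 2 = 0" using inf d(1) by (simp add: zero_power)
      then show False using \<open>v $ 1 = 0\<close> True v(1) by (simp add: vec_eq_iff forall_3)
    qed
    then have "v = v $ 1 *s vector [1, v $ 2 / v $ 1, 0]"
      using True by (simp add: vec_eq_iff forall_3)
    then have "P = proj_point (vector [1, v $ 2 / v $ 1, 0])"
      using v1 v(2) proj_point_scale by metis
    moreover have "mpol_eval F (vector [1, v $ 2 / v $ 1, 0]) = 0"
    proof (rule vanishes_on_closed_fibers[OF d])
      show "reflect_poly f \<noteq> 0"
        using f by auto
      \<comment> \<open>The constant term of \<open>reflect_poly f\<close> is the leading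
        coefficient 1 of \<open>f\<close>.\<close>
      show "(v $ 2 / v $ 1) ^ d = poly (reflect_poly f) 0"
        using inf v1 f by (simp add: power_divide)
      fix t y :: 'a
      assume t: "t \<noteq> 0" and "y ^ d = poly (reflect_poly f) t"
      then have "(y / t) ^ d = poly f (1 / t)"
        by (simp add: poly_reflect_poly_nz f(1) power_divide inverse_eq_divide)
      then have "mpol_eval F (vector [1 / t, y / t, 1]) = 0"
        using van by (simp add: vanishes_at_proj_point[OF F])
      moreover have "vector [1, y, t] = t *s (vector [1 / t, y / t, 1] :: 'a ^ 3)"
        using t by (simp add: vec_eq_iff forall_3)
      ultimately show "mpol_eval F (vector [1, y, t]) = 0"
        by (simp add: mpol_eval_scale[OF F])
    qed
    ultimately show ?thesis
      by (simp add: vanishes_at_proj_point[OF F])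
  qed
  then show "P \<in> plane_closure ?A"
    using v by (auto simp: plane_closure_def zariski_closure_def proj_space_def)
qed

section \<open>The Chebyshev curve in characteristic \<open>p\<close>\<close>

text \<open>Trades the definite description for the recursion, along which base change and
  evaluation are proved by induction.\<close>

lemma chebyshev_eq_chebyshev_rec: "d > 0 \<Longrightarrow> chebyshev d = (chebyshev_rec d :: 'a::field poly)"
  using is_chebyshev_chebyshev[of d, where ?'a = 'a]
  by (intro laurent_subst_inj) (simp add: is_chebyshev_def laurent_subst_chebyshev_rec)

lemma map_poly_to_ac_chebyshev_rec: "map_poly to_ac (chebyshev_rec n) = chebyshev_rec n"
proof (induction n rule: chebyshev_rec.induct)
  case (3 n)
  have "map_poly to_ac (f - g) = map_poly to_ac f - map_poly to_ac g" for f g :: "'a poly"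
    by (rule poly_eqI) (simp add: coeff_map_poly)
  with 3 show ?case
    by (simp add: map_poly_pCons)
qed (simp_all add: map_poly_pCons)

lemma poly_chebyshev_rec:
  fixes t u :: "'a::field"
  assumes "t * u = 1"
  shows "poly (chebyshev_rec n) (t + u) = t ^ n + u ^ n"
proof (induction n rule: chebyshev_rec.induct)
  case (3 n)
  \<comment> \<open>A polynomial identity in independent \<open>t\<close> and \<open>u\<close>; its
    last summand vanishes because \<open>t * u = 1\<close>.\<close>
  have "(t + u) * (t ^ Suc n + u ^ Suc n) - (t ^ n + u ^ n) =
      t ^ Suc (Suc n) + u ^ Suc (Suc n) + (t * u - 1) * (t ^ n + u ^ n)"
    by (simp add: algebra_simps)
  with 3 assms show ?case by simp
qed simp_all

text \<open>A root t of T^2 - xT + 1 gives x = t + 1/t; then \<open>s\<close> is a square root of t.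
  Squares are wanted so that x + 2 and x - 2 become (s + u)^2 and (s - u)^2.\<close>

lemma obtain_sum_of_inverse_squares:
  fixes x :: "'a::alg_closed_field"
  obtains s u where "s * u = 1" and "x = s\<^sup>2 + u\<^sup>2"
proof -
  obtain t where "poly [:1, -x, 1:] t = 0"
    using alg_closed_imp_poly_has_root[of "[:1, -x, 1:]"] by auto
  then have t: "t * t + 1 = x * t"
    by (simp add: algebra_simps)
  then have "t \<noteq> 0" by auto
  obtain s where s: "s\<^sup>2 = t"
    using nth_root_exists[of 2 t] by auto
  show ?thesis
  proof
    show "s * (1 / s) = 1"
      using s \<open>t \<noteq> 0\<close> by auto
    show "x = s\<^sup>2 + (1 / s)\<^sup>2"
      using s t \<open>t \<noteq> 0\<close> by (simp add: power_divide field_simps)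
  qed
qed

lemma chebyshev_rec_frobenius:
  fixes x :: "'a::alg_closed_field"
  assumes "prime CHAR('a)" and q: "q = CHAR('a) ^ r" and d: "2 * d = q + 1"
  shows "2 * poly (chebyshev_rec d) x = (x + 2) ^ d + (x - 2) ^ d"
proof -
  obtain s u where su: "s * u = 1" and x: "x = s\<^sup>2 + u\<^sup>2"
    by (rule obtain_sum_of_inverse_squares)
  have "odd q" using d by presburger
  have frob: "(a + b) ^ q = a ^ q + b ^ q" for a b :: 'a
    by (rule freshmans_dream'[OF assms(1) q])
  have double: "(a\<^sup>2) ^ d = a ^ q * a" for a :: 'a
    by (simp add: d power_Suc2 flip: power_mult)
  have "s\<^sup>2 * u\<^sup>2 = 1"
    using su by (simp flip: power_mult_distrib)
  then have "poly (chebyshev_rec d) x = s ^ q * s + u ^ q * u"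
    by (simp only: x poly_chebyshev_rec double)
  \<comment> \<open>Writing \<open>s + (- u)\<close> lets \<open>frob\<close> apply to both;
    \<open>q\<close> odd gives (-u)^q = -u^q, and the mixed terms s^q u and u^q s cancel in the
    sum.\<close>
  moreover have "x + 2 = (s + u)\<^sup>2" "x - 2 = (s + (- u))\<^sup>2"
    using su by (simp_all add: x power2_eq_square algebra_simps)
  ultimately show ?thesis
    using \<open>odd q\<close> by (simp only: double frob power_minus_odd) (simp add: algebra_simps)
qed

lemma homogenization_chebyshev_rec:
  fixes x z :: "'a::alg_closed_field"
  assumes "prime CHAR('a)" and "q = CHAR('a) ^ r" and d: "2 * d = q + 1"
  shows "2 * homogenization d (chebyshev_rec d) x z = (x + 2 * z) ^ d + (x - 2 * z) ^ d"
proof -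
  have "d = Suc (d - 1)" using d by simp
  then have f: "degree (chebyshev_rec d :: 'a poly) = d" "coeff (chebyshev_rec d) d = (1 :: 'a)"
    using chebyshev_rec_monic[of "d - 1", where ?'a = 'a] by auto
  show ?thesis
  proof (cases "z = 0")
    case True
    then show ?thesis by (simp add: homogenization_0 f)
  next
    case False
    have "2 * homogenization d (chebyshev_rec d) x z = z ^ d * (2 * poly (chebyshev_rec d) (x / z))"
      using False by (simp add: homogenization_nonzero f)
    also have "\<dots> = (z * (x / z + 2)) ^ d + (z * (x / z - 2)) ^ d"
      by (simp only: chebyshev_rec_frobenius[OF assms] power_mult_distrib distrib_left[of "z ^ d"])
    finally show ?thesis
      using False by (simp add: algebra_simps)
  qed
qed

section \<open>The Fermat equation and a d-th root of 2\<close>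

lemma degree_monom_plus_1:
  "d > 0 \<Longrightarrow> degree (monom 1 d + 1 :: 'a::field poly) = d"
  by (subst degree_add_eq_left) (simp_all add: degree_monom_eq)

lemma homogenization_fermat:
  assumes "d > 0"
  shows "homogenization d (monom 1 d + 1) u w = u ^ d + w ^ d"
proof (cases "w = 0")
  case True
  then show ?thesis
    using assms by (simp add: homogenization_0 zero_power)
next
  case False
  then show ?thesis
    using assms by (simp add: homogenization_nonzero degree_monom_plus_1 poly_monom
        distrib_left power_divide)
qed

lemma obtain_root_of_2:
  assumes "prime p" and q: "q = p ^ r" and d: "2 * d = q + 1"
    and char: "CHAR('k::{field, finite}) = p" and card: "CARD('k) = q\<^sup>2"
    and "(2 :: 'k) \<noteq> 0"
  obtains c :: "'k::{field, finite}" where "c ^ d = 2"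
proof -
  have "d > 0" using d by simp
  then obtain c :: "'k alg_closure" where c: "c ^ d = 2"
    using nth_root_exists by blast
  have q1: "q = Suc (q - 1)"
    using \<open>prime p\<close> q by (simp add: prime_gt_0_nat)
  \<comment> \<open>Frobenius fixes 2, an element of the prime field.\<close>
  have "(1 + 1 :: 'k alg_closure) ^ q = 1 ^ q + 1 ^ q"
    by (rule freshmans_dream'[where n = r]) (use assms in simp_all)
  then have "(2 :: 'k alg_closure) ^ q = 2" by simp
  then have "2 * (2 :: 'k alg_closure) ^ (q - 1) = 2"
    using q1 by (metis power_Suc)
  moreover have "(2 :: 'k alg_closure) \<noteq> 0"
    using assms(6) by (metis to_ac_eq_0_iff to_ac_numeral)
  ultimately have one: "(2 :: 'k alg_closure) ^ (q - 1) = 1" by simp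
  have "q\<^sup>2 = 2 * d * (q - 1) + 1"
    unfolding d by (subst (1 2) q1) (simp add: power2_eq_square algebra_simps)
  \<comment> \<open>With \<open>d\<close> in front, c^d = 2 is substituted first, and what remains
    is the square of 2^(q-1) = 1, times \<open>c\<close>.\<close>
  also have "\<dots> = d * ((q - 1) * 2) + 1" by simp
  finally have "c ^ CARD('k) = (c ^ d) ^ ((q - 1) * 2) * c"
    unfolding card by (simp only: power_add power_mult power_one_right)
  also have "\<dots> = c"
    by (simp only: c power_mult one) simp
  finally obtain c' :: 'k where "c = to_ac c'"
    using range_to_ac_finite by blast
  then have "to_ac (c' ^ d) = to_ac 2"
    using c by simp
  then show ?thesis
    using that by (simp only: to_ac_eq_iff)
qed

theorem proposition3p1:
  fixes p q r d :: nat
  assumes "prime p"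
    and "r \<ge> 1" and "q = p ^ r"
    and "d > 0" and "2 * d = q + 1"
    and "CARD('k::{field, finite}) = q\<^sup>2"
  shows "isomorphic_over TYPE('k) (chebyshev_curve TYPE('k) d) (fermat_curve TYPE('k) d)"
proof -
  have char: "CHAR('k) = p"
    by (rule CHAR_of_CARD_prime_power[where n = "r * 2"]) (use assms in \<open>simp_all add: power_mult\<close>)
  have "CHAR('k) dvd q"
    using assms(2,3) char by simp
  then have "of_nat q = (0 :: 'k)"
    by (simp only: of_nat_eq_0_iff_char_dvd)
  \<comment> \<open>Modulo \<open>p\<close>, 2d = q + 1 becomes 1. So the image \<open>h\<close> of
    \<open>d\<close> is the inverse of 2, and neither 2 nor \<open>d\<close> vanishes in
    \<open>'k\<close>.\<close>
  then have "of_nat (2 * d) = (1 :: 'k)"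
    by (simp add: assms(5))
  moreover define h where "h = (of_nat d :: 'k)"
  ultimately have h: "2 * h = 1"
    by simp
  then have two: "(2 :: 'k) \<noteq> 0" and "h \<noteq> 0"
    by auto
  have d: "of_nat d \<noteq> (0 :: 'k alg_closure)"
    using \<open>h \<noteq> 0\<close> unfolding h_def by (metis to_ac_eq_0_iff to_ac_of_nat)
  have prime_char: "prime CHAR('k alg_closure)" and q: "q = CHAR('k alg_closure) ^ r"
    using assms char by simp_all
  obtain c :: 'k where c: "c ^ d = 2"
    using obtain_root_of_2[OF assms(1,3,5) char assms(6) two] .
  have "c \<noteq> 0"
    using c two assms(4) by (auto simp: zero_power)
  define A :: "'k ^ 3 ^ 3" where
    "A = vector [vector [1, 0, 2], vector [0, c, 0], vector [1, 0, -2]]"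
  \<comment> \<open>Solves U = X + 2Z, W = X - 2Z: X = (U + W)/2 and Z = (U - W)/4, where
    \<open>h\<close> is 1/2 and \<open>h * h\<close> is 1/4.\<close>
  define B :: "'k ^ 3 ^ 3" where
    "B = vector [vector [h, 0, h], vector [0, 1 / c, 0], vector [h * h, 0, - (h * h)]]"
  have hh: "h + h = 1" "2 * (h * h) = h" "h * h * 2 = h" "h * 2 = 1"
    using h by (simp_all add: mult_2 mult.commute flip: mult.assoc)
  have AB: "A ** B = mat 1" and BA: "B ** A = mat 1"
    using \<open>c \<noteq> 0\<close> by (simp_all add: A_def B_def matrix_matrix_mult_def mat_def vec_eq_iff forall_3 sum_3 hh)
  have deg: "degree (chebyshev_rec d :: 'k alg_closure poly) = d"
    and lead: "lead_coeff (chebyshev_rec d :: 'k alg_closure poly) = 1"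
    using chebyshev_rec_monic[of "d - 1", where ?'a = "'k alg_closure"] assms(4) by auto
  have C: "chebyshev_curve TYPE('k) d =
      {proj_point v | v. v \<noteq> 0 \<and> (v $ 2) ^ d = homogenization d (chebyshev_rec d) (v $ 1) (v $ 3)}"
    unfolding chebyshev_curve_def chebyshev_eq_chebyshev_rec[OF assms(4)] map_poly_to_ac_chebyshev_rec
    by (rule plane_closure_superelliptic[OF assms(4) d deg lead])
  have "fermat_curve TYPE('k) d = plane_closure {(x, y). y ^ d = poly (monom 1 d + 1) x}"
    by (simp add: fermat_curve_def poly_monom)
  also have "\<dots> = {proj_point v | v. v \<noteq> 0 \<and> (v $ 2) ^ d = homogenization d (monom 1 d + 1) (v $ 1) (v $ 3)}"
    by (rule plane_closure_superelliptic[OF assms(4) d])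
      (use assms(4) in \<open>simp_all add: degree_monom_plus_1\<close>)
  finally have F: "fermat_curve TYPE('k) d =
      {proj_point v | v. v \<noteq> 0 \<and> (v $ 2) ^ d = (v $ 1) ^ d + (v $ 3) ^ d}"
    by (simp only: homogenization_fermat[OF assms(4)])
  have "(v $ 2) ^ d = homogenization d (chebyshev_rec d) (v $ 1) (v $ 3) \<longleftrightarrow>
      ((matrix_to_ac A *v v) $ 2) ^ d = ((matrix_to_ac A *v v) $ 1) ^ d + ((matrix_to_ac A *v v) $ 3) ^ d"
    for v :: "'k alg_closure ^ 3"
  proof -
    have "(matrix_to_ac A *v v) $ 1 = v $ 1 + 2 * v $ 3"
      "(matrix_to_ac A *v v) $ 2 = to_ac c * v $ 2"
      "(matrix_to_ac A *v v) $ 3 = v $ 1 - 2 * v $ 3"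
      by (simp_all add: A_def matrix_to_ac_def matrix_vector_mult_def sum_3)
    moreover have "to_ac c ^ d = 2"
      by (simp add: c flip: to_ac_power)
    moreover have "(2 :: 'k alg_closure) \<noteq> 0"
      using two by (metis to_ac_eq_0_iff to_ac_numeral)
    \<comment> \<open>Here (cY)^d = 2 Y^d, and the sum of the other two powers is twice the
      homogenized Chebyshev polynomial; the common factor 2 is nonzero and cancels.\<close>
    ultimately show ?thesis
      by (simp add: power_mult_distrib flip: homogenization_chebyshev_rec[OF prime_char q assms(5)])
  qed
  then show ?thesis
    by (rule isomorphic_over_linear[OF AB BA C F])
qed

end
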